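(* Let $K\ge 2$ and $N\ge\deg(\phi)$ be integers, let $(\tilde C_{k,n})_{0\le k\le K,\,0\le n\le N}$ be the solution of the semi-discrete scheme, and set $\tilde r:=\tilde C_0$, $\tilde m:=\tilde C_1$, $\tilde e:=\tilde C_2$. 1. For a general potential $\phi$: if $\langle\tilde r\rangle=0$ at $t=0$, then $\langle\tilde r\rangle=0$ for all $t\ge0$. Likewise, if $\frac{1}{\sqrt2}\langle\tilde e\rangle+\langle\phi\tilde r\rangle=0$ at $t=0$, then this holds for all $t\ge0$. 2. If $\phi$ is harmonic: if $\langle\tilde r x\rangle=0$ and $\langle\tilde m\rangle=0$ at $t=0$, then both hold for all $t\ge0$. Likewise, if $\langle\tilde r\rangle=0$, $\langle\tilde m x\rangle=0$ and $\frac{1}{\sqrt2}\langle\tilde e\rangle-\langle\phi\tilde r\rangle=0$ at $t=0$, then these three equalities hold for all $t\ge0$.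
   Context: Potential. $\phi:\mathbb{R}\to\mathbb{R}$ is an even polynomial of degree $2m$, $m\ge 1$, with positive leading coefficient; $\rho:=e^{-\phi}$ and it is assumed that $\int_{\mathbb{R}}\rho\,dx=1$ and $\int_{\mathbb{R}}\phi''\rho\,dx=1$. The potential is called harmonic if $\phi(x)=\frac12(x^2+\ln(2\pi))$. Notation. $\langle f,g\rangle=\int_{\mathbb{R}} fg\rho\,dx$, $\langle f\rangle=\int_{\mathbb{R}} f\rho\,dx$. $\mu(v)=\frac{1}{\sqrt{2\pi}}e^{-v^2/2}$, $\mathcal{M}(x,v)=\mu(v)\rho(x)$. $(\tilde P_n)_{n\ge0}$ are the orthonormal polynomials for the weight $\rho$ ($\deg\tilde P_n=n$, positive leading coefficient) and $(\tilde H_k)_{k\ge0}$ the orthonormal (Hermite) polynomials for the weight $\mu$. $\delta_{k\ge3}=1$ if $k\ge3$ and $0$ otherwise. Semi-discrete scheme. Given $K,N\in\mathbb{N}$ and $h_0\in L^2(\mathbb{R}\times\mathbb{R},\mathcal{M}\,dx\,dv)$, the coefficients $\tilde C_{k,n}(t)$, $0\le k\le K$, $0\le n\le N$, $t\ge 0$, solve the linear ODE system $$\frac{d}{dt}\tilde C_{k,n}=\sqrt{k+1}\sum_{r=0}^N\langle\tilde P_r,\partial_x\tilde P_n\rangle\tilde C_{k+1,r}-\sqrt{k}\sum_{r=0}^N\langle\tilde P_n,\partial_x\tilde P_r\rangle\tilde C_{k-1,r}-\delta_{k\ge3}\tilde C_{k,n},$$ with $\tilde C_{-1,n}=\tilde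 C_{K+1,n}=0$ and $\tilde C_{k,n}(0)=\int_{\mathbb{R}\times\mathbb{R}}h_0\tilde P_n(x)\tilde H_k(v)\mathcal{M}\,dx\,dv$. Set $\tilde C_k(t,x)=\sum_{n=0}^N\tilde C_{k,n}(t)\tilde P_n(x)$. *)

theory Defs
  imports "HOL-Probability.Probability" "HOL-Computational_Algebra.Polynomial"
begin

definition wavg :: "(real \<Rightarrow> real) \<Rightarrow> (real \<Rightarrow> real) \<Rightarrow> real" where
  "wavg w f = (LINT x|lborel. f x * w x)"

definition winner :: "(real \<Rightarrow> real) \<Rightarrow> (real \<Rightarrow> real) \<Rightarrow> (real \<Rightarrow> real) \<Rightarrow> real" where
  "winner w f g = (LINT x|lborel. f x * g x * w x)"

definition gibbs :: "real poly \<Rightarrow> real \<Rightarrow> real" where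
  "gibbs \<phi> x = exp (- poly \<phi> x)"

text \<open>A Bochner integral of a non-integrable function is 0, so the two normalisations
  below include integrability.\<close>

definition admissible_potential :: "real poly \<Rightarrow> bool" where
  "admissible_potential \<phi> \<longleftrightarrow>
     (\<forall>x. poly \<phi> (- x) = poly \<phi> x) \<and>
     (\<exists>m\<ge>1. degree \<phi> = 2 * m) \<and>
     lead_coeff \<phi> > 0 \<and>
     (LINT x|lborel. gibbs \<phi> x) = 1 \<and>
     wavg (gibbs \<phi>) (poly (pderiv (pderiv \<phi>))) = 1"

definition harmonic_potential :: "real poly \<Rightarrow> bool" where
  "harmonic_potential \<phi> \<longleftrightarrow> (\<forall>x. poly \<phi> x = (x\<^sup>2 + ln (2 * pi)) / 2)"

definition orthonormal_polys :: "(real \<Rightarrow> real) \<Rightarrow> (nat \<Rightarrow> real poly) \<Rightarrow> bool" where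
  "orthonormal_polys w P \<longleftrightarrow>
     (\<forall>n. degree (P n) = n \<and> lead_coeff (P n) > 0) \<and>
     (\<forall>i j. winner w (poly (P i)) (poly (P j)) = (if i = j then 1 else 0))"

text \<open>The weight \<open>\<M>(x,v) = \<mu>(v) \<rho>(x)\<close>, where \<open>\<mu>\<close> is the standard normal density.\<close>

definition maxwellian :: "real poly \<Rightarrow> real \<times> real \<Rightarrow> real" where
  "maxwellian \<phi> = (\<lambda>(x, v). std_normal_density v * gibbs \<phi> x)"

definition weighted_L2 :: "real poly \<Rightarrow> (real \<times> real \<Rightarrow> real) \<Rightarrow> bool" where
  "weighted_L2 \<phi> h \<longleftrightarrow>
     h \<in> borel_measurable lebesgue \<and>
     integrable lebesgue (\<lambda>z. (h z)\<^sup>2 * maxwellian \<phi> z)"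

text \<open>The coefficients are \<open>C k n t\<close>; only indices \<open>k \<le> K\<close>, \<open>n \<le> N\<close> are used, and the two
  conditionals implement the closure \<open>C (-1) n = C (K + 1) n = 0\<close>.\<close>

definition scheme_rhs ::
  "real poly \<Rightarrow> (nat \<Rightarrow> real poly) \<Rightarrow> nat \<Rightarrow> nat \<Rightarrow> (nat \<Rightarrow> nat \<Rightarrow> real \<Rightarrow> real)
    \<Rightarrow> nat \<Rightarrow> nat \<Rightarrow> real \<Rightarrow> real" where
  "scheme_rhs \<phi> P K N C k n t =
     sqrt (real k + 1) *
       (\<Sum>r\<le>N. winner (gibbs \<phi>) (poly (P r)) (poly (pderiv (P n))) *
          (if k = K then 0 else C (k + 1) r t))
     - sqrt (real k) *
       (\<Sum>r\<le>N. winner (gibbs \<phi>) (poly (P n)) (poly (pderiv (P r))) *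
          (if k = 0 then 0 else C (k - 1) r t))
     - (if k \<ge> 3 then 1 else 0) * C k n t"

text \<open>The derivative is taken within \<open>[0,\<infinity>)\<close>, hence one-sided at \<open>t = 0\<close>.\<close>

definition scheme_solution ::
  "real poly \<Rightarrow> (nat \<Rightarrow> real poly) \<Rightarrow> (nat \<Rightarrow> real poly) \<Rightarrow> nat \<Rightarrow> nat
    \<Rightarrow> (real \<times> real \<Rightarrow> real) \<Rightarrow> (nat \<Rightarrow> nat \<Rightarrow> real \<Rightarrow> real) \<Rightarrow> bool" where
  "scheme_solution \<phi> P H K N h0 C \<longleftrightarrow>
     (\<forall>k\<le>K. \<forall>n\<le>N.
        C k n 0 = (LINT z|lebesgue. h0 z * poly (P n) (fst z) * poly (H k) (snd z) * maxwellian \<phi> z) \<and>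
        (\<forall>t\<ge>0. (C k n has_real_derivative scheme_rhs \<phi> P K N C k n t) (at t within {0..})))"

definition profile ::
  "(nat \<Rightarrow> real poly) \<Rightarrow> nat \<Rightarrow> (nat \<Rightarrow> nat \<Rightarrow> real \<Rightarrow> real) \<Rightarrow> nat \<Rightarrow> real \<Rightarrow> real \<Rightarrow> real" where
  "profile P N C k t x = (\<Sum>n\<le>N. C k n t * poly (P n) x)"

end

theory Submission
  imports Defs
begin

text \<open>
  Write \<open>L p = \<integral> p \<rho> dx\<close> for the mean of a polynomial against the Gibbs weight
  \<open>\<rho> = exp (- \<phi>)\<close>, and \<open>c k t\<close> for the polynomial whose coordinates in the orthonormal
  basis \<open>P 0, \<dots>, P N\<close> are the unknowns \<open>C k n t\<close>. The scheme is a Galerkin projection of the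
  hierarchy of Hermite moment equations. Tested against a polynomial \<open>q\<close> of degree at most \<open>N\<close>
  the projection is invisible, because \<open>q\<close> lies in the span of the basis; the result is the
  exact weak form
  \<open>d/dt L (c k q) = sqrt (k + 1) L (c (k + 1) q') - sqrt k L ((c (k - 1))' q) - \<delta> L (c k q)\<close>
  (lemma \<open>scheme_weak_form\<close>), where \<open>c (- 1)\<close> and \<open>c (K + 1)\<close> count as \<open>0\<close> and the relaxation
  factor \<open>\<delta>\<close> is \<open>1\<close> for \<open>k \<ge> 3\<close> and \<open>0\<close> otherwise. All the quantities of the proposition are moments of this kind
  with \<open>q\<close> equal to \<open>1\<close>, \<open>x\<close> or \<open>\<phi>\<close>; the last is admissible since \<open>N \<ge> degree \<phi>\<close>.
  The other ingredient is integration by parts, \<open>L (p') = L (p \<phi>')\<close>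
  (lemma \<open>gibbs_mean_pderiv\<close>).

  For a general potential, testing the equation of order \<open>0\<close> with \<open>1\<close> gives conservation of mass.
  Testing it with \<open>\<phi>\<close>, and that of order \<open>2\<close> with \<open>1\<close>, gives
  \<open>d/dt L (c 0 \<phi>) = L (c 1 \<phi>')\<close> and \<open>d/dt L (c 2) / sqrt 2 = - L ((c 1)') = - L (c 1 \<phi>')\<close>,
  so the sum of the potential and kinetic parts of the energy is conserved.

  If \<open>\<phi>\<close> is harmonic, then \<open>\<phi>' = x\<close> and the moment equations close. The pair
  \<open>(L (c 0 x), L (c 1))\<close> solves the oscillator \<open>f' = g\<close>, \<open>g' = - f\<close>. Once the mass vanishes, the
  pair \<open>(L (c 1 x), L (c 2) / sqrt 2 - L (c 0 \<phi>))\<close> solves \<open>f' = 2 g\<close>, \<open>g' = - 2 f\<close>. In both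
  cases \<open>f\<^sup>2 + g\<^sup>2\<close> is constant, so zero initial data stay zero
  (lemma \<open>rotation_from_rest\<close>).
\<close>

section \<open>Bases of polynomials with one member in each degree\<close>

text \<open>Each basis member has the degree of its index, so it can be used to cancel the leading
  term; the remainder then has smaller degree.\<close>

lemma polynomials_of_each_degree_span:
  fixes P :: "nat \<Rightarrow> 'a::field poly"
  assumes deg: "\<And>n. degree (P n) = n" and nz: "\<And>n. P n \<noteq> 0"
    and q: "degree q \<le> N"
  shows "\<exists>a. q = (\<Sum>n\<le>N. smult (a n) (P n))"
  using q
proof (induction N arbitrary: q)
  case 0
  obtain b where b: "P 0 = [:b:]"
    using degree_eq_zeroE[OF deg] by metis
  obtain c where c: "q = [:c:]"
    using 0 degree_eq_zeroE by (metis le_zero_eq)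
  have "b \<noteq> 0" using nz[of 0] b by auto
  then have "q = (\<Sum>n\<le>0. smult (c / b) (P n))"
    using b c by simp
  then show ?case by (rule exI[of _ "\<lambda>_. c / b"])
next
  case (Suc N)
  let ?l = "coeff q (Suc N) / lead_coeff (P (Suc N))"
  let ?p = "q - smult ?l (P (Suc N))"
  have l: "lead_coeff (P (Suc N)) \<noteq> 0" using nz by simp
  have "degree ?p \<le> N"
  proof (rule degree_le, intro allI impI)
    fix i assume "N < i"
    then consider "i = Suc N" | "Suc N < i" by linarith
    then show "coeff ?p i = 0"
    proof cases
      case 1
      then show ?thesis using l deg by simp
    next
      case 2
      then show ?thesis using deg Suc.prems by (simp add: coeff_eq_0)
    qed
  qed
  then obtain a where a: "?p = (\<Sum>n\<le>N. smult (a n) (P n))"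
    using Suc.IH by blast
  have "q = (\<Sum>n\<le>Suc N. smult ((a(Suc N := ?l)) n) (P n))"
    using a by (simp add: algebra_simps)
  then show ?case by blast
qed

section \<open>Means of polynomials against the Gibbs weight\<close>

text \<open>The mean is taken on formal polynomials rather than on functions, so that linearity and
  integration by parts become algebraic rules.\<close>

definition gibbs_mean :: "real poly \<Rightarrow> real poly \<Rightarrow> real" where
  "gibbs_mean \<phi> p = wavg (gibbs \<phi>) (poly p)"

lemma winner_eq_gibbs_mean:
  "winner (gibbs \<phi>) (poly p) (poly q) = gibbs_mean \<phi> (p * q)"
  by (simp add: winner_def gibbs_mean_def wavg_def)

lemma gibbs_measurable [measurable]: "gibbs \<phi> \<in> borel_measurable borel"
  unfolding gibbs_def[abs_def] by (intro borel_measurable_continuous_onI continuous_intros)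

lemma poly_measurable [measurable]: "poly (p :: real poly) \<in> borel_measurable borel"
  by (intro borel_measurable_continuous_onI continuous_intros)

text \<open>Bochner integrals of non-integrable functions are \<open>0\<close>. As \<open>\<rho>\<close> and \<open>(P n)\<^sup>2 \<rho>\<close> have
  integral \<open>1\<close>, they are integrable, and \<open>\<bar>P n\<bar> \<le> 1 + (P n)\<^sup>2\<close> makes each \<open>P n \<rho>\<close> integrable.
  The \<open>P n\<close> span all polynomials.\<close>

lemma integrable_poly_gibbs:
  assumes pot: "admissible_potential \<phi>" and P: "orthonormal_polys (gibbs \<phi>) P"
  shows "integrable lborel (\<lambda>x. poly p x * gibbs \<phi> x)"
proof -
  have deg: "degree (P n) = n" and nz: "P n \<noteq> 0" for n
    using P unfolding orthonormal_polys_def by (metis, metis leading_coeff_0_iff less_irrefl)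
  have rho: "integrable lborel (gibbs \<phi>)"
    using pot not_integrable_integral_eq[of lborel "gibbs \<phi>"]
    unfolding admissible_potential_def by fastforce
  have basis: "integrable lborel (\<lambda>x. poly (P n) x * gibbs \<phi> x)" for n
  proof -
    have "(LINT x|lborel. poly (P n) x * poly (P n) x * gibbs \<phi> x) = 1"
      using P unfolding orthonormal_polys_def winner_def by simp
    then have "integrable lborel (\<lambda>x. poly (P n) x * poly (P n) x * gibbs \<phi> x)"
      using not_integrable_integral_eq by fastforce
    with rho have "integrable lborel
        (\<lambda>x. gibbs \<phi> x + poly (P n) x * poly (P n) x * gibbs \<phi> x)"
      by (rule Bochner_Integration.integrable_add)
    then show ?thesis
    proof (rule Bochner_Integration.integrable_bound)
      have "\<bar>y\<bar> \<le> 1 + y * y" for y :: real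
        using zero_le_square[of "\<bar>y\<bar> - 1"] by (simp add: algebra_simps) 
      then have "\<bar>poly (P n) x\<bar> * gibbs \<phi> x
          \<le> (1 + poly (P n) x * poly (P n) x) * gibbs \<phi> x" for x
        by (intro mult_right_mono) (auto simp: gibbs_def)
      then show "AE x in lborel. norm (poly (P n) x * gibbs \<phi> x)
          \<le> norm (gibbs \<phi> x + poly (P n) x * poly (P n) x * gibbs \<phi> x)"
        using order_trans[OF _ abs_ge_self] by (auto simp: gibbs_def abs_mult distrib_right)
    qed measurable
  qed
  obtain a where a: "p = (\<Sum>n\<le>degree p. smult (a n) (P n))"
    using polynomials_of_each_degree_span[OF deg nz order_refl] by blast
  have "integrable lborel (\<lambda>x. \<Sum>n\<le>degree p. a n * (poly (P n) x * gibbs \<phi> x))"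
    using basis by (intro Bochner_Integration.integrable_sum integrable_mult_right)
  moreover have "poly p x * gibbs \<phi> x
      = (\<Sum>n\<le>degree p. a n * (poly (P n) x * gibbs \<phi> x))" for x
    by (subst a) (simp add: poly_sum sum_distrib_right mult.assoc)
  ultimately show ?thesis by simp
qed

lemma gibbs_mean_add:
  assumes "admissible_potential \<phi>" and "orthonormal_polys (gibbs \<phi>) P"
  shows "gibbs_mean \<phi> (p + q) = gibbs_mean \<phi> p + gibbs_mean \<phi> q"
  using integrable_poly_gibbs[OF assms]
  by (simp add: gibbs_mean_def wavg_def distrib_right)

lemma gibbs_mean_smult: "gibbs_mean \<phi> (smult c p) = c * gibbs_mean \<phi> p"
  by (simp add: gibbs_mean_def wavg_def mult.assoc)

lemma gibbs_mean_diff: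
  assumes "admissible_potential \<phi>" and "orthonormal_polys (gibbs \<phi>) P"
  shows "gibbs_mean \<phi> (p - q) = gibbs_mean \<phi> p - gibbs_mean \<phi> q"
  using gibbs_mean_add[OF assms, of p "- q"] gibbs_mean_smult[of \<phi> "- 1" q] by simp

lemma gibbs_mean_sum:
  assumes "admissible_potential \<phi>" and "orthonormal_polys (gibbs \<phi>) P"
  shows "gibbs_mean \<phi> (\<Sum>i\<in>A. f i) = (\<Sum>i\<in>A. gibbs_mean \<phi> (f i))"
proof -
  have "gibbs_mean \<phi> 0 = 0" by (simp add: gibbs_mean_def wavg_def)
  then show ?thesis
    by (induction A rule: infinite_finite_induct) (simp_all add: gibbs_mean_add[OF assms])
qed

text \<open>The inner sum on the right is a row of a matrix of the scheme applied to \<open>d\<close> when \<open>A\<close>, \<open>B\<close> are the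
  basis polynomials or their derivatives, while the left side contains no coordinates. This
  turns matrix-vector products into moments.\<close>

lemma gibbs_mean_bilinear:
  assumes "admissible_potential \<phi>" and "orthonormal_polys (gibbs \<phi>) P"
  shows "gibbs_mean \<phi> ((\<Sum>i\<in>I. smult (d i) (A i)) * (\<Sum>j\<in>J. smult (a j) (B j)))
    = (\<Sum>j\<in>J. a j * (\<Sum>i\<in>I. gibbs_mean \<phi> (A i * B j) * d i))"
  unfolding sum_product
  by (subst sum.swap)
    (simp add: gibbs_mean_sum[OF assms] gibbs_mean_smult sum_distrib_left mult_ac)

section \<open>Integration by parts\<close>

text \<open>From degree \<open>2\<close> on, \<open>\<phi> - x\<close> has the leading coefficient of \<open>\<phi>\<close>, hence \<open>\<phi> \<ge> x\<close> near
  infinity and the weight is dominated by \<open>exp (- x)\<close>.\<close>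

lemma poly_gibbs_at_top:
  assumes deg: "degree \<phi> \<ge> 2" and lc: "lead_coeff \<phi> > 0"
  shows "((\<lambda>x. poly p x * gibbs \<phi> x) \<longlongrightarrow> 0) at_top"
proof -
  have "degree [:0, 1:: real:] < degree \<phi>" using deg by simp
  then have "degree (\<phi> - [:0, 1:]) = degree \<phi>"
    using degree_add_eq_left[of "- [:0, 1:]" \<phi>]
    by (simp only: diff_conv_add_uminus degree_minus)
  moreover have "coeff [:0, 1:: real:] (degree \<phi>) = 0"
    using \<open>degree [:0, 1:: real:] < degree \<phi>\<close> by (rule coeff_eq_0)
  ultimately have "lead_coeff (\<phi> - [:0, 1:]) = lead_coeff \<phi>" by simp
  then obtain B where B: "\<And>x. B \<le> x \<Longrightarrow> lead_coeff \<phi> \<le> poly \<phi> x - x"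
    using poly_pinfty_gt_lc[of "\<phi> - [:0, 1:]"] lc by auto
  have bound: "\<forall>\<^sub>F x in at_top. norm (x ^ i * gibbs \<phi> x) \<le> norm (x ^ i / exp x)" for i
  proof (rule eventually_at_top_linorderI[of B])
    fix x assume "B \<le> x"
    with B lc have "x \<le> poly \<phi> x" by fastforce
    then have "gibbs \<phi> x \<le> 1 / exp x" 
      by (simp add: gibbs_def exp_minus field_simps)
    then have "\<bar>x ^ i\<bar> * gibbs \<phi> x \<le> \<bar>x ^ i\<bar> * (1 / exp x)"
      by (rule mult_left_mono) simp
    then show "norm (x ^ i * gibbs \<phi> x) \<le> norm (x ^ i / exp x)"
      by (simp add: abs_mult gibbs_def)
  qed
  have "((\<lambda>x. x ^ i * gibbs \<phi> x) \<longlongrightarrow> 0) at_top" for i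
    using bound by (rule Lim_null_comparison) (intro tendsto_norm_zero tendsto_power_div_exp_0)
  then have "((\<lambda>x. \<Sum>i\<le>degree p. coeff p i * (x ^ i * gibbs \<phi> x)) \<longlongrightarrow> 0) at_top"
    by (intro tendsto_null_sum tendsto_mult_right_zero)
  then show ?thesis
    by (simp add: poly_altdef sum_distrib_right mult.assoc)
qed

text \<open>The derivative of \<open>p \<rho>\<close> is \<open>(p' - p \<phi>') \<rho>\<close>, and \<open>p \<rho>\<close> vanishes at both ends of the line.
  Evenness of \<open>\<phi>\<close> reduces the decay at \<open>- \<infinity>\<close> to that at \<open>\<infinity>\<close>.\<close>

lemma gibbs_mean_pderiv:
  assumes pot: "admissible_potential \<phi>" and P: "orthonormal_polys (gibbs \<phi>) P"
  shows "gibbs_mean \<phi> (pderiv p) = gibbs_mean \<phi> (p * pderiv \<phi>)"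
proof -
  let ?F = "\<lambda>x. poly p x * gibbs \<phi> x"
  let ?f = "\<lambda>x. poly (pderiv p - p * pderiv \<phi>) x * gibbs \<phi> x"
  have deg: "degree \<phi> \<ge> 2" and lc: "lead_coeff \<phi> > 0"
    and even: "poly \<phi> (- x) = poly \<phi> x" for x
    using pot unfolding admissible_potential_def by auto
  have top: "(?F \<longlongrightarrow> 0) at_top"
    using deg lc by (rule poly_gibbs_at_top)
  have bot: "(?F \<longlongrightarrow> 0) at_bot"
    using poly_gibbs_at_top[OF deg lc, of "p \<circ>\<^sub>p [:0, - 1:]"]
    unfolding filterlim_at_bot_mirror by (simp add: poly_pcompose gibbs_def even)
  have "(LBINT x=-\<infinity>..\<infinity>. ?f x) = 0 - 0"
  proof (rule interval_integral_FTC_integrable)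
    show "(?F has_vector_derivative ?f x) (at x)" for x
      unfolding gibbs_def has_real_derivative_iff_has_vector_derivative[symmetric]
      by (auto intro!: derivative_eq_intros simp: algebra_simps)
    show "isCont ?f x" for x
      unfolding gibbs_def by (intro continuous_intros)
    show "set_integrable lborel (einterval (-\<infinity>) \<infinity>) ?f"
      unfolding set_integrable_def using integrable_poly_gibbs[OF assms, of "pderiv p - p * pderiv \<phi>"]
      by simp
    show "((?F \<circ> real_of_ereal) \<longlongrightarrow> 0) (at_right (-\<infinity>))"
      using bot by (simp add: ereal_tendsto_simps1)
    show "((?F \<circ> real_of_ereal) \<longlongrightarrow> 0) (at_left \<infinity>)"
      using top by (simp add: ereal_tendsto_simps1)
  qed simp
  then have "gibbs_mean \<phi> (pderiv p - p * pderiv \<phi>) = 0"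
    by (simp add: gibbs_mean_def wavg_def interval_lebesgue_integral_def set_lebesgue_integral_def)
  then show ?thesis
    by (simp add: gibbs_mean_diff[OF assms])
qed

section \<open>The weak form of the scheme\<close>

definition profile_poly ::
  "(nat \<Rightarrow> real poly) \<Rightarrow> nat \<Rightarrow> (nat \<Rightarrow> nat \<Rightarrow> real \<Rightarrow> real) \<Rightarrow> nat \<Rightarrow> real \<Rightarrow> real poly" where
  "profile_poly P N C k t = (\<Sum>n\<le>N. smult (C k n t) (P n))"

lemma profile_eq_poly: "profile P N C k t = poly (profile_poly P N C k t)"
  by (simp add: fun_eq_iff profile_def profile_poly_def poly_sum)

text \<open>The degree bound on \<open>q\<close> makes the Galerkin projection harmless: if \<open>q\<close> has coordinates
  \<open>a n\<close>, orthonormality gives \<open>L (c k q) = \<Sum>n\<le>N. a n * C k n\<close>, and the same combination of the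
  right-hand sides reassembles \<open>q'\<close> from the first matrix and the \<open>x\<close>-derivative of
  \<open>c (k - 1)\<close> from the second.\<close>

lemma scheme_weak_form:
  assumes pot: "admissible_potential \<phi>" and P: "orthonormal_polys (gibbs \<phi>) P"
    and sol: "scheme_solution \<phi> P H K N h0 C"
    and q: "degree q \<le> N" and k: "k \<le> K" and t: "t \<ge> 0"
  defines "c \<equiv> profile_poly P N C"
  shows "((\<lambda>s. gibbs_mean \<phi> (c k s * q)) has_real_derivative
      sqrt (real k + 1) * (if k = K then 0 else gibbs_mean \<phi> (c (k + 1) t * pderiv q))
      - sqrt (real k) * (if k = 0 then 0 else gibbs_mean \<phi> (pderiv (c (k - 1) t) * q))
      - (if k \<ge> 3 then 1 else 0) * gibbs_mean \<phi> (c k t * q)) (at t within {0..})"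
proof -
  note lin = gibbs_mean_bilinear[OF pot P]
  have deg: "degree (P n) = n" and nz: "P n \<noteq> 0" for n
    using P unfolding orthonormal_polys_def by (metis, metis leading_coeff_0_iff less_irrefl)
  have ortho: "gibbs_mean \<phi> (P i * P j) = (if i = j then 1 else 0)" for i j
    using P unfolding orthonormal_polys_def winner_eq_gibbs_mean by blast
  obtain a where a: "q = (\<Sum>n\<le>N. smult (a n) (P n))"
    using polynomials_of_each_degree_span[OF deg nz q] by blast
  \<comment> \<open>The rule for the \<open>n\<close>-th derivative of a sum is used with \<open>n = 1\<close>.\<close>
  have a': "pderiv q = (\<Sum>n\<le>N. smult (a n) (pderiv (P n)))"
    unfolding a by (simp add: higher_pderiv_sum[of 1, simplified] pderiv_smult)
  have c': "pderiv (c j t) = (\<Sum>r\<le>N. smult (C j r t) (pderiv (P r)))" for j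
    unfolding c_def profile_poly_def by (simp add: higher_pderiv_sum[of 1, simplified] pderiv_smult)
  have coord: "gibbs_mean \<phi> (c j s * q) = (\<Sum>n\<le>N. a n * C j n s)" for j s
    unfolding c_def profile_poly_def a lin ortho by (simp add: if_distrib if_distribR cong: if_cong)
  have up: "gibbs_mean \<phi> (c j t * pderiv q) = (\<Sum>n\<le>N. a n *
      (\<Sum>r\<le>N. winner (gibbs \<phi>) (poly (P r)) (poly (pderiv (P n))) * C j r t))" for j
    unfolding c_def profile_poly_def a' lin winner_eq_gibbs_mean ..
  have down: "gibbs_mean \<phi> (pderiv (c j t) * q) = (\<Sum>n\<le>N. a n *
      (\<Sum>r\<le>N. winner (gibbs \<phi>) (poly (P n)) (poly (pderiv (P r))) * C j r t))" for j
    unfolding c' a lin winner_eq_gibbs_mean by (simp add: mult.commute)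
  have "((\<lambda>s. \<Sum>n\<le>N. a n * C k n s) has_real_derivative
      (\<Sum>n\<le>N. a n * scheme_rhs \<phi> P K N C k n t)) (at t within {0..})"
    using sol k t unfolding scheme_solution_def
    by (intro DERIV_sum DERIV_cmult) auto
  moreover have "(\<Sum>n\<le>N. a n * scheme_rhs \<phi> P K N C k n t) =
      sqrt (real k + 1) * (if k = K then 0 else gibbs_mean \<phi> (c (k + 1) t * pderiv q))
      - sqrt (real k) * (if k = 0 then 0 else gibbs_mean \<phi> (pderiv (c (k - 1) t) * q))
      - (if k \<ge> 3 then 1 else 0) * gibbs_mean \<phi> (c k t * q)"
    unfolding scheme_rhs_def up down coord
    by (auto simp: sum_subtractf sum_distrib_left right_diff_distrib sum_negf mult_ac)
  ultimately show ?thesis unfolding coord by simp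
qed

section \<open>Two elementary differential equations on the half-line\<close>

lemma constant_if_zero_derivative:
  fixes f :: "real \<Rightarrow> real"
  assumes "\<And>t. t \<ge> 0 \<Longrightarrow> (f has_real_derivative 0) (at t within {0..})" and "t \<ge> 0"
  shows "f t = f 0"
proof -
  have "\<exists>c. \<forall>x\<in>{0..}. f x = c"
    using assms(1) by (intro has_field_derivative_zero_constant) auto
  then show ?thesis using assms(2) by auto
qed

text \<open>The flow rotates the plane of \<open>(f, g)\<close>, so \<open>f\<^sup>2 + g\<^sup>2\<close> keeps its initial value \<open>0\<close>.\<close>

lemma rotation_from_rest:
  fixes f g :: "real \<Rightarrow> real"
  assumes f: "\<And>t. t \<ge> 0 \<Longrightarrow> (f has_real_derivative \<omega> * g t) (at t within {0..})"
    and g: "\<And>t. t \<ge> 0 \<Longrightarrow> (g has_real_derivative - \<omega> * f t) (at t within {0..})"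
    and init: "f 0 = 0" "g 0 = 0" and t: "t \<ge> 0"
  shows "f t = 0 \<and> g t = 0"
proof -
  have "((\<lambda>s. f s * f s + g s * g s) has_real_derivative 0) (at s within {0..})" if "s \<ge> 0" for s
    by (rule derivative_eq_intros f[OF that] g[OF that] refl)+ (simp add: algebra_simps)
  from constant_if_zero_derivative[OF this t] have "f t * f t + g t * g t = 0"
    using init by simp
  then show ?thesis by (simp add: sum_squares_eq_zero_iff)
qed

section \<open>Propagation of the conservation laws\<close>

theorem proposition3p1:
  fixes \<phi> :: "real poly" and P H :: "nat \<Rightarrow> real poly" and K N :: nat
    and h0 :: "real \<times> real \<Rightarrow> real" and C :: "nat \<Rightarrow> nat \<Rightarrow> real \<Rightarrow> real"
    and avg :: "(real \<Rightarrow> real) \<Rightarrow> real" and r m e :: "real \<Rightarrow> real \<Rightarrow> real"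
  assumes pot: "admissible_potential \<phi>"
    and P: "orthonormal_polys (gibbs \<phi>) P"
    and H: "orthonormal_polys std_normal_density H"
    and K: "K \<ge> 2"
    and N: "N \<ge> degree \<phi>"
    and h0: "weighted_L2 \<phi> h0"
    and C: "scheme_solution \<phi> P H K N h0 C"
  defines "avg \<equiv> wavg (gibbs \<phi>)"
    and "r \<equiv> profile P N C 0" and "m \<equiv> profile P N C 1" and "e \<equiv> profile P N C 2"
  shows
    "(avg (r 0) = 0 \<longrightarrow> (\<forall>t\<ge>0. avg (r t) = 0)) \<and>
     (1 / sqrt 2 * avg (e 0) + avg (\<lambda>x. poly \<phi> x * r 0 x) = 0 \<longrightarrow>
       (\<forall>t\<ge>0. 1 / sqrt 2 * avg (e t) + avg (\<lambda>x. poly \<phi> x * r t x) = 0)) \<and>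
     (harmonic_potential \<phi> \<longrightarrow>
       (avg (\<lambda>x. r 0 x * x) = 0 \<and> avg (m 0) = 0 \<longrightarrow>
         (\<forall>t\<ge>0. avg (\<lambda>x. r t x * x) = 0 \<and> avg (m t) = 0)) \<and>
       (avg (r 0) = 0 \<and> avg (\<lambda>x. m 0 x * x) = 0 \<and>
        1 / sqrt 2 * avg (e 0) - avg (\<lambda>x. poly \<phi> x * r 0 x) = 0 \<longrightarrow>
         (\<forall>t\<ge>0. avg (r t) = 0 \<and> avg (\<lambda>x. m t x * x) = 0 \<and>
           1 / sqrt 2 * avg (e t) - avg (\<lambda>x. poly \<phi> x * r t x) = 0)))"
proof -
  define c where "c = profile_poly P N C"
  define L where "L = gibbs_mean \<phi>"
  have r: "r t = poly (c 0 t)" and m: "m t = poly (c 1 t)" and e: "e t = poly (c 2 t)" for t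
    unfolding r_def m_def e_def c_def by (simp_all only: profile_eq_poly)
  have avg: "avg (\<lambda>x. poly p x) = L p" for p
    unfolding avg_def L_def gibbs_mean_def ..
  have avg_phi: "avg (\<lambda>x. poly \<phi> x * poly p x) = L (p * \<phi>)" for p
    unfolding avg[symmetric] by (rule arg_cong[where f = avg]) (simp add: fun_eq_iff)
  have avg_x: "avg (\<lambda>x. poly p x * x) = L (p * [:0, 1:])" for p
    unfolding avg[symmetric] by (rule arg_cong[where f = avg]) (simp add: fun_eq_iff)
  have deg: "degree \<phi> \<ge> 2"
    using pot unfolding admissible_potential_def by auto
  note weak = scheme_weak_form[OF pot P C, folded c_def L_def]
  note ibp = gibbs_mean_pderiv[OF pot P, folded L_def]
  have L0: "L 0 = 0" by (simp add: L_def gibbs_mean_def wavg_def)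
  have weak0: "((\<lambda>s. L (c 0 s * q)) has_real_derivative L (c 1 t * pderiv q)) (at t within {0..})"
    if "degree q \<le> N" "t \<ge> 0" for q t
    using weak[of q 0 t] that K by simp
  have weak1: "((\<lambda>s. L (c 1 s * q)) has_real_derivative
      sqrt 2 * L (c 2 t * pderiv q) - L (pderiv (c 0 t) * q)) (at t within {0..})"
    if "degree q \<le> N" "t \<ge> 0" for q t
    using weak[of q 1 t] that K by (simp add: numeral_2_eq_2)
  \<comment> \<open>For the test function \<open>1\<close> the flux from level \<open>3\<close>, present when \<open>K > 2\<close>, drops out,
    and relaxation acts only from level \<open>3\<close> on.\<close>
  have weak2: "((\<lambda>s. L (c 2 s)) has_real_derivative - sqrt 2 * L (c 1 t * pderiv \<phi>))
      (at t within {0..})" if "t \<ge> 0" for t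
    using weak[of 1 2 t] that K ibp[of "c 1 t"] by (simp add: L0 cong: if_cong)
  have mass_deriv: "((\<lambda>s. L (c 0 s)) has_real_derivative 0) (at t within {0..})" if "t \<ge> 0" for t
    using weak0[of 1 t] that by (simp add: L0 cong: if_cong)
  have mass_const: "L (c 0 t) = L (c 0 0)" if "t \<ge> 0" for t
    using mass_deriv that by (rule constant_if_zero_derivative)
  have kinetic: "((\<lambda>s. 1 / sqrt 2 * L (c 2 s)) has_real_derivative - L (c 1 t * pderiv \<phi>))
      (at t within {0..})" if "t \<ge> 0" for t
    using DERIV_cmult[OF weak2[OF that], of "1 / sqrt 2"] by simp
  have energy_const: "1 / sqrt 2 * L (c 2 t) + L (c 0 t * \<phi>)
      = 1 / sqrt 2 * L (c 2 0) + L (c 0 0 * \<phi>)" if "t \<ge> 0" for t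
    using _ that
  proof (rule constant_if_zero_derivative)
    fix t :: real assume "t \<ge> 0"
    then show "((\<lambda>s. 1 / sqrt 2 * L (c 2 s) + L (c 0 s * \<phi>)) has_real_derivative 0)
        (at t within {0..})"
      using DERIV_add[OF kinetic weak0[OF N]] by fastforce
  qed
  have harmonic: "(L (c 0 0 * [:0, 1:]) = 0 \<and> L (c 1 0) = 0 \<longrightarrow>
        (\<forall>t\<ge>0. L (c 0 t * [:0, 1:]) = 0 \<and> L (c 1 t) = 0)) \<and>
      (L (c 0 0) = 0 \<and> L (c 1 0 * [:0, 1:]) = 0 \<and>
        1 / sqrt 2 * L (c 2 0) - L (c 0 0 * \<phi>) = 0 \<longrightarrow>
        (\<forall>t\<ge>0. L (c 0 t) = 0 \<and> L (c 1 t * [:0, 1:]) = 0 \<and>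
          1 / sqrt 2 * L (c 2 t) - L (c 0 t * \<phi>) = 0))"
    if harm: "harmonic_potential \<phi>"
  proof -
    have "poly \<phi> = poly [:ln (2 * pi) / 2, 0, 1 / 2:]"
      using harm by (auto simp: fun_eq_iff harmonic_potential_def field_simps power2_eq_square)
    then have phi: "\<phi> = [:ln (2 * pi) / 2, 0, 1 / 2:]" by (simp only: poly_eq_poly_eq_iff)
    then have dphi: "pderiv \<phi> = [:0, 1:]" by (simp add: pderiv_pCons)
    have degx: "degree [:0, 1 :: real:] \<le> N" using deg N by simp
    have "L (c 0 t * [:0, 1:]) = 0 \<and> L (c 1 t) = 0"
      if init: "L (c 0 0 * [:0, 1:]) = 0" "L (c 1 0) = 0" and t: "t \<ge> 0" for t
    proof (rule rotation_from_rest[where \<omega> = 1 and f = "\<lambda>s. L (c 0 s * [:0, 1:])"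
          and g = "\<lambda>s. L (c 1 s)", OF _ _ init t])
      fix t :: real assume t: "t \<ge> 0"
      show "((\<lambda>s. L (c 0 s * [:0, 1:])) has_real_derivative 1 * L (c 1 t)) (at t within {0..})"
        using weak0[OF degx t] by (simp add: pderiv_pCons)
      show "((\<lambda>s. L (c 1 s)) has_real_derivative - 1 * L (c 0 t * [:0, 1:])) (at t within {0..})"
        using weak1[of 1 t] t ibp[of "c 0 t"] dphi by (simp add: L0 cong: if_cong)
    qed
    moreover have "L (c 0 t) = 0 \<and> L (c 1 t * [:0, 1:]) = 0 \<and>
          1 / sqrt 2 * L (c 2 t) - L (c 0 t * \<phi>) = 0"
      if m0: "L (c 0 0) = 0" and init: "L (c 1 0 * [:0, 1:]) = 0"
        "1 / sqrt 2 * L (c 2 0) - L (c 0 0 * \<phi>) = 0" and t: "t \<ge> 0" for t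
    proof -
      \<comment> \<open>Integration by parts gives \<open>L ((c 0)' x) = L (c 0 x\<^sup>2) - L (c 0)\<close>. With
        \<open>x\<^sup>2 = 2 \<phi> - ln (2 \<pi>)\<close> this is \<open>2 L (c 0 \<phi>)\<close> up to a multiple of the mass, which
        vanishes.\<close>
      have force: "L (pderiv (c 0 t) * [:0, 1:]) = 2 * L (c 0 t * \<phi>)" if "t \<ge> 0" for t
      proof -
        have "pderiv (c 0 t) * [:0, 1:] = pderiv (c 0 t * [:0, 1:]) - c 0 t"
          by (simp add: pderiv_mult pderiv_pCons algebra_simps)
        then have "L (pderiv (c 0 t) * [:0, 1:]) = L (c 0 t * [:0, 1:] * [:0, 1:]) - L (c 0 t)"
          using ibp[of "c 0 t * [:0, 1:]"] dphi
          by (simp only: L_def gibbs_mean_diff[OF pot P])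
        also have "c 0 t * [:0, 1:] * [:0, 1:] = smult 2 (c 0 t * \<phi>) - smult (ln (2 * pi)) (c 0 t)"
        proof -
          have square: "[:0, 1:] * [:0, 1:] = smult 2 \<phi> - [:ln (2 * pi):]"
            by (simp add: phi)
          show ?thesis by (simp only: mult.assoc square right_diff_distrib) simp
        qed
        also have "L \<dots> = 2 * L (c 0 t * \<phi>) - ln (2 * pi) * L (c 0 t)"
          unfolding L_def gibbs_mean_diff[OF pot P] gibbs_mean_smult ..
        finally show ?thesis using mass_const[OF that] m0 by simp
      qed
      have "L (c 1 t * [:0, 1:]) = 0 \<and> 1 / sqrt 2 * L (c 2 t) - L (c 0 t * \<phi>) = 0"
      proof (rule rotation_from_rest[where \<omega> = 2 and f = "\<lambda>s. L (c 1 s * [:0, 1:])"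
            and g = "\<lambda>s. 1 / sqrt 2 * L (c 2 s) - L (c 0 s * \<phi>)", OF _ _ init t])
        fix t :: real assume t: "t \<ge> 0"
        have "sqrt 2 * y = 2 * (1 / sqrt 2 * y)" for y :: real
          by (simp add: field_simps)
        then show "((\<lambda>s. L (c 1 s * [:0, 1:])) has_real_derivative
            2 * (1 / sqrt 2 * L (c 2 t) - L (c 0 t * \<phi>))) (at t within {0..})"
          using weak1[OF degx t] force[OF t] by (simp add: pderiv_pCons right_diff_distrib)
        show "((\<lambda>s. 1 / sqrt 2 * L (c 2 s) - L (c 0 s * \<phi>)) has_real_derivative
            - 2 * L (c 1 t * [:0, 1:])) (at t within {0..})"
          using DERIV_diff[OF kinetic[OF t] weak0[OF N t]] dphi by simp
      qed
      with mass_const[OF t] m0 show ?thesis by simp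
    qed
    ultimately show ?thesis by blast
  qed
  have mass: "L (c 0 0) = 0 \<longrightarrow> (\<forall>t\<ge>0. L (c 0 t) = 0)"
    using mass_const by metis
  have energy: "1 / sqrt 2 * L (c 2 0) + L (c 0 0 * \<phi>) = 0 \<longrightarrow>
      (\<forall>t\<ge>0. 1 / sqrt 2 * L (c 2 t) + L (c 0 t * \<phi>) = 0)"
    using energy_const by metis
  show ?thesis
    unfolding r m e avg_phi avg_x avg
    using mass energy harmonic by blast
qed

end
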